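(* Let $G$ be a finite simple graph. If $G$ is Sidorenko, then the box product $G\,\Box\,K_2$ is forcing.
   Context: All graphs are finite and simple; $V_G$, $E_G$ denote vertex and edge sets and $e_G=|E_G|$. For graphs $G,H$, $t(G,H)$ is the probability that a uniformly random map $\phi:V_G\to V_H$ is a graph homomorphism, i.e. $\{\phi(u),\phi(v)\}\in E_H$ for every $\{u,v\}\in E_G$. $K_2$ is a single edge. A graph $G$ is Sidorenko if $t(G,H)\ge t(K_2,H)^{e_G}$ for every graph $H$. A sequence of graphs $(H_n)_{n\in\mathbb N}$ of increasing order (number of vertices) is $p$-quasi-random if $t(J,H_n)=(1+o(1))\,p^{e_J}$ for every graph $J$. A graph $G$ is forcing if, for every $p\in[0,1]$, every sequence $(H_n)_{n\in\mathbb N}$ of graphs of increasing order with $t(K_2,H_n)=(1+o(1))\,p$ and $t(G,H_n)=(1+o(1))\,p^{e_G}$ is $p$-quasi-random. The box (cartesian) product $G\,\Box\,F$ of graphs $G$ and $F$ has vertex set $V_G\times V_F$, and $(u,v)$, $(u',v')$ are adjacent if $u=u'$ and $\{v,v'\}\in E_F$, or if $v=v'$ and $\{u,u'\}\in E_G$.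
   Formalization: The graph G is assumed to have at least one edge; for edgeless G (which is trivially Sidorenko) the product G □ K_2 is a matching, which is not forcing, as the complete bipartite graphs K_{n,n} with p = 1/2 show. *)

theory Defs
  imports Complex_Main "HOL-Library.FuncSet" "HOL-Library.Landau_Symbols"
begin

datatype 'a ugraph = UGraph (verts: "'a set") (edges: "'a set set")

definition simple_graph :: "'a ugraph \<Rightarrow> bool" where
  "simple_graph G \<longleftrightarrow> finite (verts G) \<and> (\<forall>e\<in>edges G. e \<subseteq> verts G \<and> card e = 2)"

definition K2 :: "nat ugraph" where
  "K2 = UGraph {0, 1} {{0, 1}}"

definition homs :: "'a ugraph \<Rightarrow> 'b ugraph \<Rightarrow> ('a \<Rightarrow> 'b) set" where
  "homs G H = {\<phi> \<in> verts G \<rightarrow>\<^sub>E verts H. \<forall>u v. {u, v} \<in> edges G \<longrightarrow> {\<phi> u, \<phi> v} \<in> edges H}"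

definition hom_density :: "'a ugraph \<Rightarrow> 'b ugraph \<Rightarrow> real" where
  "hom_density G H = real (card (homs G H)) / real (card (verts G \<rightarrow>\<^sub>E verts H))"

text \<open>Every finite graph has an isomorphic copy on a set of natural numbers, so quantifying over
  graphs with vertices of type \<^typ>\<open>nat\<close> amounts to quantifying over all finite graphs. The target
  graph must have a vertex for the density to be a probability.\<close>

definition sidorenko :: "'a ugraph \<Rightarrow> bool" where
  "sidorenko G \<longleftrightarrow>
    (\<forall>H :: nat ugraph. simple_graph H \<and> verts H \<noteq> {} \<longrightarrow>
      hom_density G H \<ge> hom_density K2 H ^ card (edges G))"

definition increasing_graph_seq :: "(nat \<Rightarrow> 'a ugraph) \<Rightarrow> bool" where
  "increasing_graph_seq H \<longleftrightarrow>
    (\<forall>n. simple_graph (H n)) \<and> strict_mono (\<lambda>n. card (verts (H n)))"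

text \<open>The relation \<open>f \<sim>[sequentially] (\<lambda>_. c)\<close> expresses \<open>f n = (1 + o(1)) * c\<close>; for \<open>c = 0\<close> it
  says that \<open>f n = 0\<close> for all large \<open>n\<close>.\<close>

definition quasi_random :: "real \<Rightarrow> (nat \<Rightarrow> 'a ugraph) \<Rightarrow> bool" where
  "quasi_random p H \<longleftrightarrow> increasing_graph_seq H \<and>
    (\<forall>J :: nat ugraph. simple_graph J \<longrightarrow>
      (\<lambda>n. hom_density J (H n)) \<sim>[sequentially] (\<lambda>_. p ^ card (edges J)))"

definition forcing :: "'a ugraph \<Rightarrow> bool" where
  "forcing G \<longleftrightarrow>
    (\<forall>p \<in> {0..1}. \<forall>H :: nat \<Rightarrow> nat ugraph.
      increasing_graph_seq H \<and>
      (\<lambda>n. hom_density K2 (H n)) \<sim>[sequentially] (\<lambda>_. p) \<and>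
      (\<lambda>n. hom_density G (H n)) \<sim>[sequentially] (\<lambda>_. p ^ card (edges G)) \<longrightarrow>
      quasi_random p H)"

definition box_product :: "'a ugraph \<Rightarrow> 'b ugraph \<Rightarrow> ('a \<times> 'b) ugraph" (infixl \<open>\<box>\<close> 70) where
  "G \<box> F = UGraph (verts G \<times> verts F)
    {{(u, v), (u', v')} | u v u' v'.
      u \<in> verts G \<and> u' \<in> verts G \<and> v \<in> verts F \<and> v' \<in> verts F \<and>
      (u = u' \<and> {v, v'} \<in> edges F \<or> v = v' \<and> {u, u'} \<in> edges G)}"

end

theory Submission
  imports Defs "HOL-Library.Nat_Bijection"
begin

text \<open>Homomorphisms from \<open>G \<box> K2\<close> to \<open>H\<close> are homomorphisms from \<open>G\<close> to the graph \<open>H'\<close> of oriented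
  edges of \<open>H\<close>. Since \<open>H'\<close> has \<open>t(K2, H) n\<^sup>2\<close> vertices and \<open>t(C4, H) n\<^sup>4\<close> oriented edges, the Sidorenko
  property of \<open>G\<close> applied to \<open>H'\<close> gives
  \<open>t(G \<box> K2, H) \<ge> t(K2, H) ^ v * (t(C4, H) / t(K2, H)\<^sup>2) ^ e\<close>, where \<open>v\<close> and \<open>e\<close> count the vertices
  and edges of \<open>G\<close>. As \<open>G \<box> K2\<close> has \<open>v + 2 e\<close> edges and \<open>e > 0\<close>, the hypotheses force
  \<open>t(C4, H\<^sub>n) \<longlonglongrightarrow> p ^ 4\<close>, and the 4-cycle is forcing by the argument of Chung, Graham and Wilson: both
  the degrees and the codegrees concentrate, so by Cauchy-Schwarz the cut norm of the adjacency
  matrix minus its mean vanishes, and any \<open>J\<close> can be counted by replacing its edges one at a time.\<close>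

section \<open>Averages and the cut norm\<close>

definition avg :: "'a set \<Rightarrow> ('a \<Rightarrow> real) \<Rightarrow> real" where
  "avg V f = (\<Sum>x\<in>V. f x) / real (card V)"

lemma avg_const: "finite V \<Longrightarrow> V \<noteq> {} \<Longrightarrow> avg V (\<lambda>_. c) = c"
  by (simp add: avg_def)

lemma avg_add: "avg V (\<lambda>x. f x + g x) = avg V f + avg V g"
  by (simp add: avg_def sum.distrib add_divide_distrib)

lemma avg_diff: "avg V (\<lambda>x. f x - g x) = avg V f - avg V g"
  by (simp add: avg_def sum_subtractf diff_divide_distrib)

lemma avg_cmult: "avg V (\<lambda>x. c * f x) = c * avg V f"
  by (simp add: avg_def sum_distrib_left)

lemma avg_multc: "avg V (\<lambda>x. f x * c) = avg V f * c"
  by (simp add: avg_def sum_distrib_right)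

lemma avg_mono: "(\<And>x. x \<in> V \<Longrightarrow> f x \<le> g x) \<Longrightarrow> avg V f \<le> avg V g"
  by (simp add: avg_def divide_right_mono sum_mono)

lemma avg_cong: "(\<And>x. x \<in> V \<Longrightarrow> f x = g x) \<Longrightarrow> avg V f = avg V g"
  by (simp add: avg_def)

lemma avg_swap: "avg V (\<lambda>x. avg W (\<lambda>y. f x y)) = avg W (\<lambda>y. avg V (\<lambda>x. f x y))"
  by (simp add: avg_def sum_divide_distrib[symmetric] sum.swap[of f W V] mult.commute)

lemma avg_mult_avg: "avg V f * avg W g = avg V (\<lambda>x. avg W (\<lambda>y. f x * g y))"
  by (simp add: avg_cmult avg_multc)

lemma avg_variance:
  assumes "finite V" "V \<noteq> {}"
  shows "avg V (\<lambda>x. (f x - c)\<^sup>2) = avg V (\<lambda>x. (f x)\<^sup>2) - 2 * c * avg V f + c\<^sup>2"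
proof -
  have "avg V (\<lambda>x. (f x - c)\<^sup>2) = avg V (\<lambda>x. (f x)\<^sup>2 - 2 * c * f x + c\<^sup>2)"
    by (intro avg_cong) (simp add: power2_eq_square algebra_simps)
  then show ?thesis
    by (simp only: avg_add avg_diff avg_cmult avg_const[OF assms])
qed

lemma avg_power2_le:
  assumes "finite V" "V \<noteq> {}"
  shows "(avg V f)\<^sup>2 \<le> avg V (\<lambda>x. (f x)\<^sup>2)"
proof -
  have "0 \<le> avg V (\<lambda>x. (f x - avg V f)\<^sup>2)"
    unfolding avg_def by (intro divide_nonneg_nonneg sum_nonneg) auto
  then show ?thesis
    unfolding avg_variance[OF assms] by (simp add: power2_eq_square)
qed

lemma avg_avg_power2_le:
  assumes "finite V" "V \<noteq> {}"
  shows "(avg V (\<lambda>x. avg V (f x)))\<^sup>2 \<le> avg V (\<lambda>x. avg V (\<lambda>y. (f x y)\<^sup>2))"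
  by (rule order_trans[OF avg_power2_le[OF assms]]) (intro avg_mono avg_power2_le assms)

section \<open>Degree and codegree moments of a symmetric kernel\<close>

context
  fixes V :: "'a set" and a :: "'a \<Rightarrow> 'a \<Rightarrow> real" and q t4 \<delta> :: real
    and d :: "'a \<Rightarrow> real" and c :: "'a \<Rightarrow> 'a \<Rightarrow> real"
  assumes fin: "finite V" and ne: "V \<noteq> {}"
    and sym: "\<And>x y. a x y = a y x"
  defines "d \<equiv> \<lambda>x. avg V (a x)"
    and "c \<equiv> \<lambda>y z. avg V (\<lambda>x. a x y * a x z)"
  defines "q \<equiv> avg V d"
    and "t4 \<equiv> avg V (\<lambda>y. avg V (\<lambda>z. (c y z)\<^sup>2))"
  defines "\<delta> \<equiv> t4 - q ^ 4"
begin

text \<open>Both sides count cherries: on the left by their two ends, on the right by their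
  centre.\<close>

lemma avg_codegree: "avg V (\<lambda>y. avg V (c y)) = avg V (\<lambda>x. (d x)\<^sup>2)"
proof -
  have "avg V (\<lambda>x. (d x)\<^sup>2) = avg V (\<lambda>x. avg V (\<lambda>y. avg V (\<lambda>z. a x y * a x z)))"
    by (simp add: d_def power2_eq_square avg_mult_avg)
  also have "\<dots> = avg V (\<lambda>y. avg V (\<lambda>x. avg V (\<lambda>z. a x y * a x z)))"
    by (rule avg_swap)
  also have "\<dots> = avg V (\<lambda>y. avg V (c y))"
    unfolding c_def by (intro avg_cong avg_swap)
  finally show ?thesis by simp
qed

lemma power2_density_le: "q\<^sup>2 \<le> avg V (\<lambda>x. (d x)\<^sup>2)"
  unfolding q_def by (rule avg_power2_le[OF fin ne])

lemma power2_cherry_le: "(avg V (\<lambda>x. (d x)\<^sup>2))\<^sup>2 \<le> t4"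
  unfolding t4_def avg_codegree[symmetric] by (rule avg_avg_power2_le[OF fin ne])

text \<open>Cauchy-Schwarz is used twice: from edges to cherries, then from cherries to
  4-cycles.\<close>

lemma C4_excess_nonneg: "0 \<le> \<delta>"
proof -
  have "q ^ 4 = (q\<^sup>2)\<^sup>2" by simp
  also have "\<dots> \<le> (avg V (\<lambda>x. (d x)\<^sup>2))\<^sup>2"
    by (intro power_mono power2_density_le) auto
  also note power2_cherry_le
  finally show ?thesis by (simp add: \<delta>_def)
qed

text \<open>The second moment of the codegrees is \<open>t4\<close> and their mean is at least
  \<open>q\<^sup>2\<close>, so their mean square distance from \<open>q\<^sup>2\<close> is at most
  the excess \<delta>.\<close>

lemma codegree_deviation: "avg V (\<lambda>y. avg V (\<lambda>z. \<bar>c y z - q\<^sup>2\<bar>)) \<le> sqrt \<delta>"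
proof (rule real_le_rsqrt)
  let ?M = "avg V (\<lambda>x. (d x)\<^sup>2)"
  have "(avg V (\<lambda>y. avg V (\<lambda>z. \<bar>c y z - q\<^sup>2\<bar>)))\<^sup>2 \<le> avg V (\<lambda>y. avg V (\<lambda>z. (c y z - q\<^sup>2)\<^sup>2))"
    using avg_avg_power2_le[OF fin ne, of "\<lambda>y z. \<bar>c y z - q\<^sup>2\<bar>"] by simp
  also have "\<dots> = t4 - 2 * q\<^sup>2 * ?M + (q\<^sup>2)\<^sup>2"
    by (simp only: avg_variance[OF fin ne] avg_add avg_diff avg_cmult avg_const[OF fin ne]
        avg_codegree t4_def)
  also have "\<dots> \<le> t4 - 2 * q\<^sup>2 * q\<^sup>2 + (q\<^sup>2)\<^sup>2"
    using mult_left_mono[OF power2_density_le, of "2 * q\<^sup>2"] by simp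
  also have "\<dots> = \<delta>"
    by (simp add: \<delta>_def power2_eq_square power4_eq_xxxx)
  finally show "(avg V (\<lambda>y. avg V (\<lambda>z. \<bar>c y z - q\<^sup>2\<bar>)))\<^sup>2 \<le> \<delta>" .
qed

text \<open>The variance of the degrees is the excess of the cherry density over
  \<open>q\<^sup>2\<close>. The square of the cherry density is at most
  \<open>q ^ 4 + \<delta>\<close>, which leaves a variance of at most
  \<open>sqrt \<delta>\<close>.\<close>

lemma degree_deviation: "avg V (\<lambda>x. \<bar>d x - q\<bar>) \<le> sqrt (sqrt \<delta>)"
proof (rule real_le_rsqrt)
  let ?M = "avg V (\<lambda>x. (d x)\<^sup>2)"
  have "(avg V (\<lambda>x. \<bar>d x - q\<bar>))\<^sup>2 \<le> avg V (\<lambda>x. (d x - q)\<^sup>2)"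
    using avg_power2_le[OF fin ne, of "\<lambda>x. \<bar>d x - q\<bar>"] by simp
  also have "\<dots> = ?M - q\<^sup>2"
    unfolding avg_variance[OF fin ne] q_def[symmetric] by (simp add: power2_eq_square)
  also have "\<dots> \<le> sqrt \<delta>"
  proof -
    have "?M\<^sup>2 \<le> (q\<^sup>2)\<^sup>2 + \<delta>"
      using power2_cherry_le by (simp add: \<delta>_def)
    also have "\<dots> \<le> (q\<^sup>2 + sqrt \<delta>)\<^sup>2"
      using C4_excess_nonneg by (simp add: power2_sum)
    finally show ?thesis
      using power2_le_imp_le[of ?M "q\<^sup>2 + sqrt \<delta>"] C4_excess_nonneg by simp
  qed
  finally show "(avg V (\<lambda>x. \<bar>d x - q\<bar>))\<^sup>2 \<le> sqrt \<delta>" .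
qed

text \<open>Cauchy-Schwarz in \<open>x\<close> removes \<open>f\<close> at the cost of a square.
  Expanding that square over pairs \<open>y\<close>, \<open>z\<close> and averaging over
  \<open>x\<close> leaves only codegrees and degrees, whose mean deviations are already
  bounded.\<close>

lemma cut_deviation:
  assumes q1: "\<bar>q\<bar> \<le> 1"
    and f: "\<And>x. x \<in> V \<Longrightarrow> \<bar>f x\<bar> \<le> 1" and g: "\<And>y. y \<in> V \<Longrightarrow> \<bar>g y\<bar> \<le> 1"
  shows "\<bar>avg V (\<lambda>x. avg V (\<lambda>y. (a x y - q) * (f x * g y)))\<bar> \<le> sqrt (sqrt \<delta> + 2 * sqrt (sqrt \<delta>))"
proof -
  define h where "h x = avg V (\<lambda>y. (a x y - q) * g y)" for x
  have "avg V (\<lambda>x. avg V (\<lambda>y. (a x y - q) * (f x * g y))) = avg V (\<lambda>x. f x * h x)"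
    by (simp add: h_def avg_cmult[symmetric] mult_ac)
  \<comment> \<open>The preceding equation is substituted under the square, so the chain from here
    on bounds the square of the cut average.\<close>
  also have "(avg V (\<lambda>x. f x * h x))\<^sup>2 \<le> avg V (\<lambda>x. (f x * h x)\<^sup>2)"
    by (rule avg_power2_le[OF fin ne])
  also have "\<dots> \<le> avg V (\<lambda>x. (h x)\<^sup>2)"
    using f by (intro avg_mono) (simp add: power_mult_distrib mult_left_le_one_le abs_square_le_1)
  also have "\<dots> = avg V (\<lambda>x. avg V (\<lambda>y. avg V (\<lambda>z. (a x y - q) * g y * ((a x z - q) * g z))))"
    by (simp add: h_def power2_eq_square avg_mult_avg)
  also have "\<dots> = avg V (\<lambda>y. avg V (\<lambda>x. avg V (\<lambda>z. (a x y - q) * g y * ((a x z - q) * g z))))"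
    by (rule avg_swap)
  also have "\<dots> = avg V (\<lambda>y. avg V (\<lambda>z. avg V (\<lambda>x. (a x y - q) * g y * ((a x z - q) * g z))))"
    by (intro avg_cong avg_swap)
  also have "\<dots> \<le> avg V (\<lambda>y. avg V (\<lambda>z. \<bar>c y z - q\<^sup>2\<bar> + (\<bar>d y - q\<bar> + \<bar>d z - q\<bar>)))"
  proof (intro avg_mono)
    fix y z assume yz: "y \<in> V" "z \<in> V"
    have dd: "avg V (\<lambda>x. a x w) = d w" for w
      by (simp add: d_def sym[of _ w])
    have "avg V (\<lambda>x. (a x y - q) * g y * ((a x z - q) * g z))
        = avg V (\<lambda>x. (g y * g z) * (a x y * a x z - q * a x y - q * a x z + q * q))"
      by (intro avg_cong) (simp add: algebra_simps)
    also have "\<dots> = (g y * g z) * (c y z - q * d y - q * d z + q * q)"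
      by (simp add: avg_cmult avg_add avg_diff avg_const[OF fin ne] dd c_def)
    also have "\<dots> \<le> \<bar>g y * g z\<bar> * \<bar>c y z - q * d y - q * d z + q * q\<bar>"
      by (metis abs_ge_self abs_mult)
    also have "\<dots> \<le> 1 * \<bar>c y z - q * d y - q * d z + q * q\<bar>"
      using g[OF yz(1)] g[OF yz(2)] mult_mono[of "\<bar>g y\<bar>" 1 "\<bar>g z\<bar>" 1]
      by (intro mult_right_mono) (auto simp: abs_mult)
    \<comment> \<open>Regrouped around the expected values: \<open>q\<^sup>2\<close> for the
      codegree and \<open>q\<close> for each degree.\<close>
    also have "c y z - q * d y - q * d z + q * q = (c y z - q\<^sup>2) - (q * (d y - q) + q * (d z - q))"
      by (simp add: power2_eq_square algebra_simps)
    also have "1 * \<bar>\<dots>\<bar> \<le> \<bar>c y z - q\<^sup>2\<bar> + (\<bar>q * (d y - q)\<bar> + \<bar>q * (d z - q)\<bar>)"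
    proof -
      have "1 * \<bar>r - (s + t)\<bar> \<le> \<bar>r\<bar> + (\<bar>s\<bar> + \<bar>t\<bar>)" for r s t :: real
        by (simp add: abs_if)
      then show ?thesis by blast
    qed
    also have "\<dots> \<le> \<bar>c y z - q\<^sup>2\<bar> + (\<bar>d y - q\<bar> + \<bar>d z - q\<bar>)"
      using q1 by (intro add_mono order_refl) (simp_all add: abs_mult mult_left_le_one_le)
    finally show "avg V (\<lambda>x. (a x y - q) * g y * ((a x z - q) * g z))
      \<le> \<bar>c y z - q\<^sup>2\<bar> + (\<bar>d y - q\<bar> + \<bar>d z - q\<bar>)" .
  qed
  also have "\<dots> = avg V (\<lambda>y. avg V (\<lambda>z. \<bar>c y z - q\<^sup>2\<bar>)) + 2 * avg V (\<lambda>x. \<bar>d x - q\<bar>)"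
    by (simp add: avg_add avg_const[OF fin ne])
  also have "\<dots> \<le> sqrt \<delta> + 2 * sqrt (sqrt \<delta>)"
    using codegree_deviation degree_deviation by simp
  finally show ?thesis
    by (intro real_le_rsqrt) simp
qed

end

section \<open>Averages over maps\<close>

lemma avg_abs_le:
  assumes "\<And>x. x \<in> V \<Longrightarrow> \<bar>f x\<bar> \<le> c" "finite V" "V \<noteq> {}"
  shows "\<bar>avg V f\<bar> \<le> c"
proof -
  have "avg V f \<le> avg V (\<lambda>_. c)" "avg V (\<lambda>_. - c) \<le> avg V f"
    by (intro avg_mono; use assms(1) in fastforce)+
  then show ?thesis
    using avg_const[OF assms(2,3)] by (simp add: abs_le_iff)
qed

text \<open>A uniform map on \<open>insert u S\<close> is a uniform value at \<open>u\<close>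
  together with an independent uniform map on \<open>S\<close>; this lets single vertices be
  integrated out.\<close>

lemma avg_PiE_insert:
  assumes "finite S" "u \<notin> S"
  shows "avg (insert u S \<rightarrow>\<^sub>E X) F = avg X (\<lambda>x. avg (S \<rightarrow>\<^sub>E X) (\<lambda>\<psi>. F (\<psi>(u := x))))"
proof -
  have "(\<Sum>\<phi>\<in>insert u S \<rightarrow>\<^sub>E X. F \<phi>) = (\<Sum>(x, \<psi>)\<in>X \<times> (S \<rightarrow>\<^sub>E X). F (\<psi>(u := x)))"
    unfolding PiE_insert_eq
    by (subst sum.reindex[OF inj_combinator[OF assms(2)]]) (simp add: case_prod_unfold)
  then show ?thesis
    using assms
    by (simp add: avg_def card_PiE sum.cartesian_product[symmetric] sum_divide_distrib[symmetric])
qed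

lemma avg_PiE_empty: "avg ({} \<rightarrow>\<^sub>E X) F = F (\<lambda>_. undefined)"
  by (simp add: avg_def)

section \<open>Counting homomorphisms through 4-cycles\<close>

definition adj :: "'a ugraph \<Rightarrow> 'a \<Rightarrow> 'a \<Rightarrow> real" where
  "adj H x y = of_bool ({x, y} \<in> edges H)"

lemma adj_commute: "adj H x y = adj H y x"
  by (simp add: adj_def insert_commute)

text \<open>A 4-cycle is a pair of opposite vertices \<open>y\<close>, \<open>z\<close> together with two common neighbours, hence
  the squared codegree.\<close>

definition C4_density :: "'a ugraph \<Rightarrow> real" where
  "C4_density H = avg (verts H) (\<lambda>y. avg (verts H) (\<lambda>z.
     (avg (verts H) (\<lambda>x. adj H x y * adj H x z))\<^sup>2))"

lemma finite_edges:
  assumes "simple_graph G"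
  shows "finite (edges G)"
proof (rule finite_subset)
  show "edges G \<subseteq> Pow (verts G)" "finite (Pow (verts G))"
    using assms by (auto simp: simple_graph_def)
qed

lemma simple_graph_edgeE:
  assumes "simple_graph G" "e \<in> edges G"
  obtains u v where "e = {u, v}" "u \<noteq> v" "u \<in> verts G" "v \<in> verts G"
proof -
  have "card e = 2" "e \<subseteq> verts G"
    using assms by (auto simp: simple_graph_def)
  then show ?thesis
    using that by (auto simp: card_2_iff)
qed

lemma simple_graph_doubletonD:
  assumes "simple_graph G" "{u, v} \<in> edges G"
  shows "u \<noteq> v" "u \<in> verts G" "v \<in> verts G"
proof -
  have "card {u, v} = 2" "{u, v} \<subseteq> verts G"
    using assms unfolding simple_graph_def by blast+
  then show "u \<noteq> v" "u \<in> verts G" "v \<in> verts G" by auto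
qed

text \<open>Quantifying over edges instead of ordered pairs makes it possible to impose the
  condition on a subset of the edges only, as the edge-by-edge count requires.\<close>

lemma homs_image:
  assumes "simple_graph G"
  shows "homs G H = {\<phi> \<in> verts G \<rightarrow>\<^sub>E verts H. \<forall>e\<in>edges G. \<phi> ` e \<in> edges H}"
proof -
  have "(\<forall>u v. {u, v} \<in> edges G \<longrightarrow> {\<phi> u, \<phi> v} \<in> edges H) \<longleftrightarrow> (\<forall>e\<in>edges G. \<phi> ` e \<in> edges H)"
    for \<phi> :: "'a \<Rightarrow> 'b"
  proof (intro iffI ballI allI impI)
    fix e assume *: "\<forall>u v. {u, v} \<in> edges G \<longrightarrow> {\<phi> u, \<phi> v} \<in> edges H" "e \<in> edges G"
    obtain u v where "e = {u, v}"
      using simple_graph_edgeE[OF assms *(2)] .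
    with * show "\<phi> ` e \<in> edges H" by simp
  next
    fix u v assume "\<forall>e\<in>edges G. \<phi> ` e \<in> edges H" "{u, v} \<in> edges G"
    then have "\<phi> ` {u, v} \<in> edges H" by (rule bspec)
    then show "{\<phi> u, \<phi> v} \<in> edges H" by simp
  qed
  then show ?thesis by (simp add: homs_def)
qed

lemma hom_density_avg:
  assumes "simple_graph G" "finite (verts H)"
  shows "hom_density G H =
    avg (verts G \<rightarrow>\<^sub>E verts H) (\<lambda>\<phi>. of_bool (\<forall>e\<in>edges G. \<phi> ` e \<in> edges H))"
proof -
  have "finite (verts G \<rightarrow>\<^sub>E verts H)"
    using assms by (auto simp: simple_graph_def intro: finite_PiE)
  then show ?thesis
    by (simp add: hom_density_def avg_def homs_image[OF assms(1)] Int_def of_bool_def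
        sum.If_cases)
qed

lemma simple_graph_K2: "simple_graph K2"
  by (simp add: simple_graph_def K2_def)

lemma hom_density_K2:
  assumes "finite (verts H)"
  shows "hom_density K2 H = avg (verts H) (\<lambda>x. avg (verts H) (adj H x))"
  unfolding hom_density_avg[OF simple_graph_K2 assms]
  \<comment> \<open>\<open>PiE_empty_domain\<close> would rewrite the empty product before
    \<open>avg_PiE_empty\<close> can be applied.\<close>
  by (simp add: K2_def avg_PiE_insert avg_PiE_empty adj_def[abs_def] del: PiE_empty_domain)

lemma hom_density_bounds: "0 \<le> hom_density G H" "hom_density G H \<le> 1"
proof -
  have "card (homs G H) \<le> card (verts G \<rightarrow>\<^sub>E verts H)" if "finite (verts G \<rightarrow>\<^sub>E verts H)"
    using that by (intro card_mono) (auto simp: homs_def)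
  then show "hom_density G H \<le> 1"
    \<comment> \<open>If there are infinitely many maps, \<open>card\<close> is 0 and the quotient
      is 0 by the convention for division.\<close>
    by (cases "finite (verts G \<rightarrow>\<^sub>E verts H)") (auto simp: hom_density_def divide_le_eq_1)
qed (simp add: hom_density_def)

text \<open>Once the vertices other than the endpoints \<open>u\<close>, \<open>v\<close> of \<open>e\<close> are mapped, each remaining edge of
  the simple graph \<open>J\<close> constrains the image of at most one of \<open>u\<close> and \<open>v\<close>, so the count is a cut
  average of \<open>adj H x y - q\<close>.\<close>

lemma counting_step:
  assumes J: "simple_graph J" and F: "insert e F \<subseteq> edges J" "e \<notin> F"
    and V: "finite (verts H)" "verts H \<noteq> {}"
    and cut: "\<And>f g. \<lbrakk>\<And>x. \<bar>f x\<bar> \<le> 1; \<And>y. \<bar>g y\<bar> \<le> 1\<rbrakk> \<Longrightarrow>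
      \<bar>avg (verts H) (\<lambda>x. avg (verts H) (\<lambda>y. (adj H x y - q) * (f x * g y)))\<bar> \<le> \<epsilon>"
  defines "T \<equiv> \<lambda>F. avg (verts J \<rightarrow>\<^sub>E verts H) (\<lambda>\<phi>. of_bool (\<forall>e\<in>F. \<phi> ` e \<in> edges H))"
  shows "\<bar>T (insert e F) - q * T F\<bar> \<le> \<epsilon>"
proof -
  let ?V = "verts H"
  obtain u v where e: "e = {u, v}" "u \<noteq> v" "u \<in> verts J" "v \<in> verts J"
    using simple_graph_edgeE[OF J, of e] F by blast
  define S where "S = verts J - {u, v}"
  have S: "verts J = insert u (insert v S)" "u \<notin> insert v S" "v \<notin> S" "finite S"
    using e J by (auto simp: S_def simple_graph_def)
  define P where "P \<phi> = (of_bool (\<forall>e\<in>F. \<phi> ` e \<in> edges H) :: real)" for \<phi>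
  \<comment> \<open>The indicator for \<open>insert e F\<close> is that for \<open>F\<close> times
    \<open>adj H (\<phi> u) (\<phi> v)\<close>.\<close>
  have "T (insert e F) - q * T F = avg (verts J \<rightarrow>\<^sub>E ?V) (\<lambda>\<phi>. (adj H (\<phi> u) (\<phi> v) - q) * P \<phi>)"
    unfolding T_def avg_cmult[symmetric] avg_diff[symmetric]
    by (intro avg_cong) (simp add: e adj_def P_def)
  also have "\<dots> = avg ?V (\<lambda>x. avg ?V (\<lambda>y. avg (S \<rightarrow>\<^sub>E ?V)
      (\<lambda>\<psi>. (adj H x y - q) * P (\<psi>(v := y, u := x)))))"
    using S e by (simp add: avg_PiE_insert)
  also have "\<dots> = avg ?V (\<lambda>x. avg (S \<rightarrow>\<^sub>E ?V) (\<lambda>\<psi>. avg ?V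
      (\<lambda>y. (adj H x y - q) * P (\<psi>(v := y, u := x)))))"
    by (intro avg_cong avg_swap)
  also have "\<dots> = avg (S \<rightarrow>\<^sub>E ?V) (\<lambda>\<psi>. avg ?V (\<lambda>x. avg ?V
      (\<lambda>y. (adj H x y - q) * P (\<psi>(v := y, u := x)))))"
    by (rule avg_swap)
  also have "\<bar>\<dots>\<bar> \<le> \<epsilon>"
  proof (rule avg_abs_le)
    fix \<psi> :: "'a \<Rightarrow> 'b"
    \<comment> \<open>The factor \<open>f\<close> collects the edges of \<open>F\<close> at
      \<open>u\<close>, and \<open>g\<close> all the others. An edge at \<open>u\<close> does not
      see \<open>y\<close> because it misses \<open>v\<close>, and the others do not see
      \<open>x\<close>.\<close>
    define f where "f x = (of_bool (\<forall>e\<in>F. u \<in> e \<longrightarrow> \<psi>(u := x) ` e \<in> edges H) :: real)" for x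
    define g where "g y = (of_bool (\<forall>e\<in>F. u \<notin> e \<longrightarrow> \<psi>(v := y) ` e \<in> edges H) :: real)" for y
    have "P (\<psi>(v := y, u := x)) = f x * g y" for x y
    proof -
      have "\<psi>(v := y, u := x) ` e' = (if u \<in> e' then \<psi>(u := x) ` e' else \<psi>(v := y) ` e')"
        if "e' \<in> F" for e'
      proof (cases "u \<in> e'")
        case True
        have "v \<notin> e'"
        proof
          assume "v \<in> e'"
          moreover have "card e' = 2" "e' \<noteq> e"
            using that F J by (auto simp: simple_graph_def)
          ultimately show False
            using True e by (metis card_2_iff doubleton_eq_iff insert_iff singletonD)
        qed
        with True show ?thesis by (auto simp: image_iff)
      qed (auto simp: image_iff)
      then have "(\<forall>e\<in>F. \<psi>(v := y, u := x) ` e \<in> edges H) \<longleftrightarrow>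
          (\<forall>e\<in>F. (if u \<in> e then \<psi>(u := x) ` e else \<psi>(v := y) ` e) \<in> edges H)"
        by (simp cong: ball_cong)
      also have "\<dots> \<longleftrightarrow> (\<forall>e\<in>F. u \<in> e \<longrightarrow> \<psi>(u := x) ` e \<in> edges H) \<and>
          (\<forall>e\<in>F. u \<notin> e \<longrightarrow> \<psi>(v := y) ` e \<in> edges H)"
        by auto
      finally show ?thesis
        unfolding P_def f_def g_def of_bool_conj[symmetric] by (rule arg_cong)
    qed
    then show "\<bar>avg ?V (\<lambda>x. avg ?V (\<lambda>y. (adj H x y - q) * P (\<psi>(v := y, u := x))))\<bar> \<le> \<epsilon>"
      using cut[of f g] by (simp add: f_def g_def)
  next
    show "finite (S \<rightarrow>\<^sub>E ?V)" "S \<rightarrow>\<^sub>E ?V \<noteq> {}"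
      using S V by (auto simp: PiE_eq_empty_iff intro: finite_PiE)
  qed
  finally show ?thesis .
qed

lemma hom_density_K2_power4_le:
  assumes "finite (verts H)" "verts H \<noteq> {}"
  shows "hom_density K2 H ^ 4 \<le> C4_density H"
  using C4_excess_nonneg[OF assms adj_commute[of H]]
  unfolding hom_density_K2[OF assms(1)] C4_density_def by simp

text \<open>Edges are added one at a time, each contributing a factor \<open>q\<close> up to an
  error \<epsilon>. Since \<open>q\<close> is at most 1, multiplying by it does not enlarge the
  errors accumulated before.\<close>

lemma C4_counting:
  assumes J: "simple_graph J" and V: "finite (verts H)" "verts H \<noteq> {}"
  defines "\<delta> \<equiv> C4_density H - hom_density K2 H ^ 4"
  shows "\<bar>hom_density J H - hom_density K2 H ^ card (edges J)\<bar>
    \<le> card (edges J) * sqrt (sqrt \<delta> + 2 * sqrt (sqrt \<delta>))"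
proof -
  define q where "q = hom_density K2 H"
  define \<epsilon> where "\<epsilon> = sqrt (sqrt \<delta> + 2 * sqrt (sqrt \<delta>))"
  define T where "T F = avg (verts J \<rightarrow>\<^sub>E verts H) (\<lambda>\<phi>. of_bool (\<forall>e\<in>F. \<phi> ` e \<in> edges H))" for F
  have q: "0 \<le> q" "q \<le> 1"
    using hom_density_bounds by (auto simp: q_def)
  have cut: "\<bar>avg (verts H) (\<lambda>x. avg (verts H) (\<lambda>y. (adj H x y - q) * (f x * g y)))\<bar> \<le> \<epsilon>"
    if "\<And>x. \<bar>f x\<bar> \<le> 1" "\<And>y. \<bar>g y\<bar> \<le> 1" for f g
    using cut_deviation[OF V adj_commute[of H], where f = f and g = g] that q
    unfolding \<epsilon>_def \<delta>_def q_def hom_density_K2[OF V(1)] C4_density_def by simp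
  \<comment> \<open>\<open>T F\<close> is the density of the spanning subgraph of \<open>J\<close>
    with edge set \<open>F\<close>, so the induction runs over \<open>F\<close> with the vertex set
    fixed.\<close>
  have "\<bar>T F - q ^ card F\<bar> \<le> card F * \<epsilon>" if "F \<subseteq> edges J" for F
    using finite_subset[OF that finite_edges[OF J]] that
  proof (induction F rule: finite_induct)
    case empty
    have "finite (verts J \<rightarrow>\<^sub>E verts H)" "verts J \<rightarrow>\<^sub>E verts H \<noteq> {}"
      using J V by (auto simp: PiE_eq_empty_iff simple_graph_def intro: finite_PiE)
    then show ?case by (simp add: T_def avg_const)
  next
    case (insert e F)
    have "\<bar>T (insert e F) - q * T F\<bar> \<le> \<epsilon>"
      unfolding T_def by (rule counting_step[OF J insert.prems insert.hyps(2) V cut])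
    moreover have "\<bar>q * T F - q * q ^ card F\<bar> \<le> card F * \<epsilon>"
    proof -
      have "\<bar>q * T F - q * q ^ card F\<bar> = q * \<bar>T F - q ^ card F\<bar>"
        using q by (simp add: abs_mult right_diff_distrib[symmetric])
      also have "\<dots> \<le> \<bar>T F - q ^ card F\<bar>"
        using q by (simp add: mult_left_le_one_le)
      finally show ?thesis using insert by simp
    qed
    ultimately show ?case
      using insert.hyps by (simp add: algebra_simps)
  qed
  from this[OF order_refl] show ?thesis
    unfolding hom_density_avg[OF J V(1)] T_def q_def \<epsilon>_def .
qed

section \<open>The box product with an edge\<close>

text \<open>A homomorphism from \<open>G \<box> K2\<close> to \<open>H\<close> is a homomorphism from \<open>G\<close> to the graph whose
  vertices are the oriented edges of \<open>H\<close>, two of them being adjacent if both their tails and their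
  heads are. Oriented edges are coded as numbers because \<^const>\<open>sidorenko\<close> only speaks about
  target graphs on numbers.\<close>

definition arc_graph :: "nat ugraph \<Rightarrow> nat ugraph" where
  "arc_graph H = UGraph (prod_encode ` {(x, y). {x, y} \<in> edges H})
    {{prod_encode (x, y), prod_encode (x', y')} | x y x' y'.
      {x, y} \<in> edges H \<and> {x', y'} \<in> edges H \<and> {x, x'} \<in> edges H \<and> {y, y'} \<in> edges H}"

lemma verts_arc_graph: "verts (arc_graph H) = prod_encode ` {(x, y). {x, y} \<in> edges H}"
  by (simp add: arc_graph_def)

text \<open>An unordered pair can be read in two orders, but the defining condition is invariant
  under exchanging the two arcs.\<close>

lemma edges_arc_graph_iff:
  "{prod_encode (x, y), prod_encode (x', y')} \<in> edges (arc_graph H) \<longleftrightarrow>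
    {x, y} \<in> edges H \<and> {x', y'} \<in> edges H \<and> {x, x'} \<in> edges H \<and> {y, y'} \<in> edges H"
  unfolding arc_graph_def ugraph.sel mem_Collect_eq doubleton_eq_iff prod_encode_eq prod.inject
  by (auto simp: insert_commute)

lemma simple_arc_graph:
  assumes "simple_graph H"
  shows "simple_graph (arc_graph H)"
proof -
  have "{(x, y). {x, y} \<in> edges H} \<subseteq> verts H \<times> verts H"
    using simple_graph_doubletonD[OF assms] by auto
  then have "finite {(x, y). {x, y} \<in> edges H}"
    using assms by (meson finite_SigmaI finite_subset simple_graph_def)
  moreover have "card {prod_encode (x, y), prod_encode (x', y')} = 2" if "{x, x'} \<in> edges H" for x y x' y'
    using simple_graph_doubletonD(1)[OF assms that] by simp
  ultimately show ?thesis
    unfolding simple_graph_def by (auto simp: arc_graph_def)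
qed

text \<open>The weight \<open>adj H x y\<close> selects the arcs among all pairs, so sums over arcs
  become sums over vertices of \<open>H\<close>.\<close>

lemma sum_arc_graph:
  fixes F :: "nat \<Rightarrow> real"
  assumes "simple_graph H"
  shows "(\<Sum>a\<in>verts (arc_graph H). F a) =
    (\<Sum>x\<in>verts H. \<Sum>y\<in>verts H. adj H x y * F (prod_encode (x, y)))"
proof -
  have fin: "finite (verts H)"
    using assms by (simp add: simple_graph_def)
  have "(\<Sum>x\<in>verts H. \<Sum>y\<in>verts H. adj H x y * F (prod_encode (x, y))) =
      (\<Sum>p\<in>verts H \<times> verts H. if p \<in> {(x, y). {x, y} \<in> edges H} then F (prod_encode p) else 0)"
    unfolding sum.cartesian_product by (intro sum.cong) (auto simp: adj_def)
  also have "\<dots> = (\<Sum>p\<in>(verts H \<times> verts H) \<inter> {(x, y). {x, y} \<in> edges H}. F (prod_encode p))"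
    using fin by (subst sum.inter_restrict) auto
  also have "(verts H \<times> verts H) \<inter> {(x, y). {x, y} \<in> edges H} = {(x, y). {x, y} \<in> edges H}"
    using simple_graph_doubletonD[OF assms] by auto
  finally show ?thesis
    by (simp add: verts_arc_graph sum.reindex inj_prod_encode)
qed

lemma card_verts_arc_graph:
  assumes "simple_graph H"
  shows "card (verts (arc_graph H)) = hom_density K2 H * card (verts H) ^ 2"
proof -
  have fin: "finite (verts H)"
    using assms by (simp add: simple_graph_def)
  have "card (verts (arc_graph H)) = (\<Sum>x\<in>verts H. \<Sum>y\<in>verts H. adj H x y)"
    using sum_arc_graph[OF assms, of "\<lambda>_. 1"] by simp
  then show ?thesis
    by (cases "verts H = {}")
       (use fin in \<open>auto simp: hom_density_K2[OF fin] avg_def sum_divide_distrib[symmetric] power2_eq_square\<close>)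
qed

text \<open>Two adjacent arcs \<open>(x, y)\<close> and \<open>(x', y')\<close> form a closed walk
  \<open>x\<close>, \<open>y\<close>, \<open>y'\<close>, \<open>x'\<close>, that is, a homomorphic
  4-cycle. The form without denominators also covers an arc graph with no vertices.\<close>

lemma hom_density_K2_arc_graph:
  assumes "simple_graph H"
  shows "hom_density K2 (arc_graph H) * card (verts (arc_graph H)) ^ 2 = C4_density H * card (verts H) ^ 4"
proof -
  let ?V = "verts H" and ?W = "verts (arc_graph H)" and ?a = "adj H"
  have fin: "finite ?V" "finite ?W"
    using assms simple_arc_graph[OF assms] by (simp_all add: simple_graph_def)
  have "hom_density K2 (arc_graph H) * card ?W ^ 2 = (\<Sum>a\<in>?W. \<Sum>b\<in>?W. adj (arc_graph H) a b)"
    by (cases "?W = {}")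
       (use fin in \<open>auto simp: hom_density_K2[OF fin(2)] avg_def sum_divide_distrib[symmetric] power2_eq_square\<close>)
  also have "\<dots> = (\<Sum>x\<in>?V. \<Sum>y\<in>?V. ?a x y * (\<Sum>x'\<in>?V. \<Sum>y'\<in>?V. ?a x' y' * (?a x x' * ?a y y')))"
    unfolding sum_arc_graph[OF assms]
    by (intro sum.cong refl) (auto simp: adj_def edges_arc_graph_iff intro!: sum.cong)
  also have "\<dots> = (\<Sum>x\<in>?V. \<Sum>y\<in>?V. \<Sum>x'\<in>?V. \<Sum>y'\<in>?V. ?a y x * ?a y y' * (?a x' x * ?a x' y'))"
    by (auto simp: sum_distrib_left adj_commute mult_ac intro!: sum.cong)
  \<comment> \<open>Two exchanges bring the opposite vertices \<open>x\<close> and \<open>y'\<close>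
    outside; the inner sums over their common neighbours \<open>y\<close> and \<open>x'\<close> then
    form a square.\<close>
  also have "\<dots> = (\<Sum>x\<in>?V. \<Sum>y\<in>?V. \<Sum>y'\<in>?V. \<Sum>x'\<in>?V. ?a y x * ?a y y' * (?a x' x * ?a x' y'))"
    by (intro sum.cong refl sum.swap)
  also have "\<dots> = (\<Sum>x\<in>?V. \<Sum>y'\<in>?V. \<Sum>y\<in>?V. \<Sum>x'\<in>?V. ?a y x * ?a y y' * (?a x' x * ?a x' y'))"
    by (intro sum.cong refl sum.swap)
  also have "\<dots> = (\<Sum>x\<in>?V. \<Sum>y'\<in>?V. (\<Sum>y\<in>?V. ?a y x * ?a y y')\<^sup>2)"
    by (simp add: power2_eq_square sum_product)
  also have "\<dots> = C4_density H * card ?V ^ 4"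
    by (cases "?V = {}")
       (use fin in \<open>auto simp: C4_density_def avg_def sum_divide_distrib[symmetric] power_divide
          power2_eq_square power4_eq_xxxx\<close>)
  finally show ?thesis .
qed

section \<open>Edges and homomorphisms of the prism over a graph\<close>

lemma verts_box_K2: "verts (G \<box> K2) = verts G \<times> {0, 1}"
  by (simp add: box_product_def K2_def)

lemma mem_edges_box_K2:
  "e \<in> edges (G \<box> K2) \<longleftrightarrow> (\<exists>u v u' v'. e = {(u, v), (u', v')} \<and>
    u \<in> verts G \<and> u' \<in> verts G \<and> v \<in> {0, 1} \<and> v' \<in> {0, 1} \<and>
    (u = u' \<and> {v, v'} = {0, 1} \<or> v = v' \<and> {u, u'} \<in> edges G))"
  by (simp only: box_product_def K2_def ugraph.sel mem_Collect_eq singleton_iff)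

lemma edges_box_K2:
  assumes "simple_graph G"
  shows "edges (G \<box> K2) = (\<lambda>u. {(u, 0), (u, 1)}) ` verts G \<union>
    (\<lambda>e. e \<times> {0}) ` edges G \<union> (\<lambda>e. e \<times> {1}) ` edges G" (is "?L = ?R")
proof
  show "?L \<subseteq> ?R"
  proof
    fix e assume "e \<in> ?L"
    then obtain u v u' v' where e: "e = {(u, v), (u', v')}" "u \<in> verts G" "v \<in> {0, 1}"
        and d: "u = u' \<and> {v, v'} = {0, 1} \<or> v = v' \<and> {u, u'} \<in> edges G"
      unfolding mem_edges_box_K2 by (elim exE conjE) (rule that)
    from d show "e \<in> ?R"
    proof (elim disjE conjE)
      assume u: "u = u'" and v: "{v, v'} = {0, 1}"
      have "e = {u} \<times> {v, v'}" unfolding e u by simp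
      also have "\<dots> = {(u, 0), (u, 1)}" unfolding v by simp
      finally show ?thesis using e(2) by simp
    next
      assume uu': "v = v'" "{u, u'} \<in> edges G"
      then have "e = {u, u'} \<times> {v}" unfolding e by simp
      then have "e \<in> (\<lambda>e. e \<times> {v}) ` edges G" using uu'(2) by (rule image_eqI)
      moreover from e(3) have "v = 0 \<or> v = 1" by simp
      ultimately show ?thesis by (elim disjE) simp_all
    qed
  qed
next
  have rung: "{(u, 0), (u, 1)} \<in> ?L" if "u \<in> verts G" for u
    unfolding mem_edges_box_K2
    by (rule exI[of _ u], rule exI[of _ 0], rule exI[of _ u], rule exI[of _ 1]) (simp add: that)
  have layer: "e \<times> {i} \<in> ?L" if e: "e \<in> edges G" and i: "i \<in> {0, 1}" for e i
  proof -
    obtain u v where uv: "e = {u, v}" "u \<in> verts G" "v \<in> verts G"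
      using simple_graph_edgeE[OF assms e] .
    have "e \<times> {i} = {(u, i), (v, i)}" unfolding uv by simp
    then show ?thesis
      unfolding mem_edges_box_K2 using uv e i
      by - (rule exI[of _ u], rule exI[of _ i], rule exI[of _ v], rule exI[of _ i], simp)
  qed
  show "?R \<subseteq> ?L"
    by (intro Un_least image_subsetI rung layer) simp_all
qed

lemma card_edges_box_K2:
  assumes "simple_graph G"
  shows "card (edges (G \<box> K2)) = card (verts G) + 2 * card (edges G)"
proof -
  let ?A = "(\<lambda>u. {(u, 0::nat), (u, 1)}) ` verts G"
  let ?B = "\<lambda>i::nat. (\<lambda>e. e \<times> {i}) ` edges G"
  \<comment> \<open>The two layers are disjoint only because edges are nonempty: the empty set times
    \<open>{0}\<close> equals the empty set times \<open>{1}\<close>.\<close>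
  have ne: "e \<noteq> {}" if "e \<in> edges G" for e
    using that assms by (auto simp: simple_graph_def)
  have fin: "finite (verts G)" "finite (edges G)"
    using assms finite_edges by (auto simp: simple_graph_def)
  have A: "card ?A = card (verts G)"
    by (rule card_image) (auto simp: inj_on_def doubleton_eq_iff)
  have B: "card (?B i) = card (edges G)" for i
    by (rule card_image) (auto simp: inj_on_def)
  have "{(u, 0), (u, 1)} \<noteq> e \<times> {i}" for u :: 'a and e and i :: nat
  proof
    assume "{(u, 0), (u, 1)} = e \<times> {i}"
    then have "(u, 0) \<in> e \<times> {i}" "(u, 1) \<in> e \<times> {i}" by blast+
    then show False by simp
  qed
  then have "?A \<inter> ?B i = {}" for i by blast
  moreover have "?B 0 \<inter> ?B 1 = {}" using ne by auto
  ultimately have "card (?A \<union> ?B 0 \<union> ?B 1) = card ?A + card (?B 0) + card (?B 1)"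
    using fin by (subst card_Un_disjoint card_Un_disjoint; simp add: Int_Un_distrib2)+
  then show ?thesis
    using A B by (simp add: edges_box_K2[OF assms])
qed

lemma homs_box_K2_iff:
  assumes "simple_graph G"
  shows "\<phi> \<in> homs (G \<box> K2) H \<longleftrightarrow> \<phi> \<in> (verts G \<times> {0, 1}) \<rightarrow>\<^sub>E verts H \<and>
    (\<forall>u\<in>verts G. {\<phi> (u, 0), \<phi> (u, 1)} \<in> edges H) \<and>
    (\<forall>u v. {u, v} \<in> edges G \<longrightarrow> {\<phi> (u, 0), \<phi> (v, 0)} \<in> edges H \<and> {\<phi> (u, 1), \<phi> (v, 1)} \<in> edges H)"
    (is "_ \<longleftrightarrow> _ \<and> ?V \<and> ?E")
proof -
  have "?V \<and> ?E" if *: "\<And>p q. {p, q} \<in> edges (G \<box> K2) \<Longrightarrow> {\<phi> p, \<phi> q} \<in> edges H"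
  proof (intro conjI allI impI ballI)
    fix u assume "u \<in> verts G"
    then show "{\<phi> (u, 0), \<phi> (u, 1)} \<in> edges H"
      by (intro *) (auto simp: box_product_def K2_def)
  next
    fix u v assume uv: "{u, v} \<in> edges G"
    have "u \<in> verts G" "v \<in> verts G"
      using simple_graph_doubletonD[OF assms uv] by auto
    then show "{\<phi> (u, 0), \<phi> (v, 0)} \<in> edges H" "{\<phi> (u, 1), \<phi> (v, 1)} \<in> edges H"
      using uv by (intro *; auto simp: box_product_def K2_def)+
  qed
  moreover have "{\<phi> p, \<phi> q} \<in> edges H" if "?V" "?E" "{p, q} \<in> edges (G \<box> K2)" for p q
  proof -
    obtain u i v j where pq: "p = (u, i)" "q = (v, j)" by (metis surj_pair)
    from that(3) consider "u = v" "u \<in> verts G" "i = 0 \<and> j = 1 \<or> i = 1 \<and> j = 0"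
      | "{u, v} \<in> edges G" "i = j" "i = 0 \<or> i = 1"
      by (auto simp: box_product_def K2_def pq doubleton_eq_iff insert_commute)
    then show ?thesis
      by cases (use that(1,2) in \<open>auto simp: pq insert_commute\<close>)
  qed
  ultimately show ?thesis
    unfolding homs_def mem_Collect_eq verts_box_K2 by blast
qed

text \<open>The images of the two ends of the rung at \<open>u\<close> form the arc assigned to
  \<open>u\<close>. Rungs thus correspond to membership in the arc graph, and the two layers to
  adjacency in it.\<close>

lemma card_homs_box_K2:
  assumes G: "simple_graph G" and H: "simple_graph H"
  shows "card (homs (G \<box> K2) H) = card (homs G (arc_graph H))"
proof (rule bij_betw_same_card)
  let ?f = "\<lambda>\<phi>. \<lambda>u\<in>verts G. prod_encode (\<phi> (u, 0), \<phi> (u, 1))"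
  let ?g = "\<lambda>\<psi>. \<lambda>(u, i)\<in>verts G \<times> {0, 1}.
    if i = (0::nat) then fst (prod_decode (\<psi> u)) else snd (prod_decode (\<psi> u))"
  note vG = simple_graph_doubletonD[OF G] and vH = simple_graph_doubletonD[OF H]
  show "bij_betw ?f (homs (G \<box> K2) H) (homs G (arc_graph H))"
  proof (rule bij_betw_byWitness[where f' = ?g])
    show "\<forall>\<phi>\<in>homs (G \<box> K2) H. ?g (?f \<phi>) = \<phi>"
    proof
      fix \<phi> assume "\<phi> \<in> homs (G \<box> K2) H"
      then have "\<phi> \<in> (verts G \<times> {0, 1}) \<rightarrow>\<^sub>E verts H"
        by (simp add: homs_box_K2_iff[OF G])
      then show "?g (?f \<phi>) = \<phi>"
        by (intro extensionalityI[of _ "verts G \<times> {0, 1}"]) (auto simp: PiE_def)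
    qed
    show "\<forall>\<psi>\<in>homs G (arc_graph H). ?f (?g \<psi>) = \<psi>"
    proof
      fix \<psi> assume "\<psi> \<in> homs G (arc_graph H)"
      then have "\<psi> \<in> verts G \<rightarrow>\<^sub>E verts (arc_graph H)"
        by (simp add: homs_def)
      then show "?f (?g \<psi>) = \<psi>"
        by (intro extensionalityI[of _ "verts G"]) (auto simp: PiE_def)
    qed
    show "?f ` homs (G \<box> K2) H \<subseteq> homs G (arc_graph H)"
    proof safe
      fix \<phi> assume "\<phi> \<in> homs (G \<box> K2) H"
      then show "?f \<phi> \<in> homs G (arc_graph H)"
        unfolding homs_box_K2_iff[OF G]
        using vG by (auto simp: homs_def[of G] verts_arc_graph edges_arc_graph_iff)
    qed
    show "?g ` homs G (arc_graph H) \<subseteq> homs (G \<box> K2) H"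
    proof safe
      fix \<psi> assume \<psi>: "\<psi> \<in> homs G (arc_graph H)"
      define r where "r u = fst (prod_decode (\<psi> u))" for u
      define s where "s u = snd (prod_decode (\<psi> u))" for u
      have rs: "\<psi> u = prod_encode (r u, s u)" for u
        by (simp add: r_def s_def)
      have V: "{r u, s u} \<in> edges H" if "u \<in> verts G" for u
      proof -
        have "prod_encode (r u, s u) \<in> verts (arc_graph H)"
          using \<psi> that unfolding rs[symmetric] homs_def by auto
        then show ?thesis by (auto simp: verts_arc_graph)
      qed
      have E: "{r u, r v} \<in> edges H \<and> {s u, s v} \<in> edges H" if "{u, v} \<in> edges G" for u v
      proof -
        have "{\<psi> u, \<psi> v} \<in> edges (arc_graph H)"
          using \<psi> that by (simp add: homs_def)
        then show ?thesis by (simp add: rs edges_arc_graph_iff)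
      qed
      show "?g \<psi> \<in> homs (G \<box> K2) H"
        unfolding homs_box_K2_iff[OF G] r_def[symmetric] s_def[symmetric]
        using V E vG vH(2,3)[OF V] by auto
    qed
  qed
qed

text \<open>The Sidorenko inequality is applied in the arc graph, whose edge density is
  \<open>C4_density H / ?q ^ 2\<close>. The factor \<open>?q ^ v\<close> converts the normalisation
  by arcs into one by pairs of vertices.\<close>

lemma sidorenko_box_K2_bound:
  fixes H :: "nat ugraph"
  assumes G: "simple_graph G" "sidorenko G" and H: "simple_graph H" "hom_density K2 H > 0"
  shows "hom_density K2 H ^ card (verts G) * (C4_density H / hom_density K2 H ^ 2) ^ card (edges G)
    \<le> hom_density (G \<box> K2) H"
proof -
  let ?q = "hom_density K2 H"
  define n where "n = real (card (verts H))"
  define m where "m = real (card (verts (arc_graph H)))"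
  define v where "v = card (verts G)"
  have fin: "finite (verts H)" "finite (verts G)" "finite (verts (arc_graph H))"
    using G H simple_arc_graph[OF H(1)] by (simp_all add: simple_graph_def)
  have "n \<noteq> 0"
    using H fin by (auto simp: n_def hom_density_K2 avg_def)
  then have n: "n > 0" by (simp add: n_def)
  have m: "m = ?q * n\<^sup>2"
    using card_verts_arc_graph[OF H(1)] by (simp add: m_def n_def)
  then have m0: "m > 0" using n H by simp
  then have ne: "verts (arc_graph H) \<noteq> {}" by (auto simp: m_def)
  have "hom_density K2 (arc_graph H) = C4_density H * n ^ 4 / m ^ 2"
    using hom_density_K2_arc_graph[OF H(1)] m0 by (simp add: m_def n_def field_simps)
  also have "\<dots> = C4_density H / ?q ^ 2"
    using n H(2) by (simp add: m power2_eq_square power4_eq_xxxx)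
  finally have t: "hom_density K2 (arc_graph H) = C4_density H / ?q ^ 2" .
  have "?q ^ v * (C4_density H / ?q ^ 2) ^ card (edges G)
      \<le> ?q ^ v * hom_density G (arc_graph H)"
    using G(2) simple_arc_graph[OF H(1)] ne H(2) unfolding sidorenko_def t[symmetric]
    by (intro mult_left_mono) auto
  also have "hom_density G (arc_graph H) = card (homs (G \<box> K2) H) / m ^ v"
    using fin by (simp add: hom_density_def card_homs_box_K2[OF G(1) H(1)] m_def v_def card_PiE)
  also have "?q ^ v * (card (homs (G \<box> K2) H) / m ^ v) = card (homs (G \<box> K2) H) / (n ^ 2) ^ v"
    using H(2) n by (simp add: m power_mult_distrib)
  also have "\<dots> = hom_density (G \<box> K2) H"
    using fin by (simp add: hom_density_def verts_box_K2 card_PiE card_cartesian_product n_def v_def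
        power_mult[symmetric] mult_2[symmetric])
  finally show ?thesis by (simp add: v_def)
qed

section \<open>Forcing\<close>

text \<open>The convention \<open>0 ^ 0 = 1\<close> covers a graph \<open>J\<close> without
  edges.\<close>

lemma hom_density_edgeless:
  assumes J: "simple_graph J" and H: "finite (verts H)" "verts H \<noteq> {}" "edges H = {}"
  shows "hom_density J H = 0 ^ card (edges J)"
proof -
  have "finite (verts J \<rightarrow>\<^sub>E verts H)" "verts J \<rightarrow>\<^sub>E verts H \<noteq> {}"
    using J H by (auto simp: PiE_eq_empty_iff simple_graph_def intro: finite_PiE)
  then show ?thesis
    unfolding hom_density_avg[OF J H(1)]
    by (cases "edges J = {}") (use H(3) finite_edges[OF J] in \<open>auto simp: avg_const\<close>)
qed

lemma edgeless_if_hom_density_K2_eq_0: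
  fixes H :: "nat ugraph"
  assumes H: "simple_graph H" "hom_density K2 H = 0"
  shows "edges H = {}"
proof (rule ccontr)
  assume "edges H \<noteq> {}"
  then obtain x y where "{x, y} \<in> edges H"
    using simple_graph_edgeE[OF H(1)] by (metis ex_in_conv)
  moreover have "card (verts (arc_graph H)) = 0"
    using card_verts_arc_graph[OF H(1)] H(2) by simp
  then have "verts (arc_graph H) = {}"
    using simple_arc_graph[OF H(1)] by (simp add: simple_graph_def)
  ultimately show False
    by (auto simp: verts_arc_graph)
qed

text \<open>This solves \<open>sidorenko_box_K2_bound\<close> for the 4-cycle density; taking the
  root requires at least one edge of \<open>G\<close>.\<close>

lemma C4_density_le_of_sidorenko:
  fixes H :: "nat ugraph"
  assumes "simple_graph G" "sidorenko G" "edges G \<noteq> {}" and H: "simple_graph H" "hom_density K2 H > 0"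
  shows "C4_density H \<le> (hom_density K2 H)\<^sup>2 *
    root (card (edges G)) (hom_density (G \<box> K2) H / hom_density K2 H ^ card (verts G))"
proof -
  let ?q = "hom_density K2 H" and ?e = "card (edges G)"
  have e: "?e > 0"
    using assms finite_edges by (auto simp: card_gt_0_iff)
  have "verts H \<noteq> {}" "finite (verts H)"
    using H by (auto simp: hom_density_K2 avg_def simple_graph_def)
  then have "0 \<le> C4_density H"
    using hom_density_K2_power4_le[of H] H(2) by (meson order_trans less_imp_le zero_le_power)
  then have "C4_density H / ?q\<^sup>2 = root ?e ((C4_density H / ?q\<^sup>2) ^ ?e)"
    using e by (simp add: real_root_power_cancel)
  also have "\<dots> \<le> root ?e (hom_density (G \<box> K2) H / ?q ^ card (verts G))"
    using sidorenko_box_K2_bound[OF assms(1,2) H] e H(2) by (simp add: pos_le_divide_eq mult.commute)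
  finally show ?thesis
    using H(2) by (simp add: pos_divide_le_eq mult.commute)
qed

lemma increasing_graph_seq_verts:
  assumes "increasing_graph_seq H"
  shows "finite (verts (H n))" "n \<ge> 1 \<Longrightarrow> verts (H n) \<noteq> {}"
proof -
  show "finite (verts (H n))"
    using assms by (simp add: increasing_graph_seq_def simple_graph_def)
  \<comment> \<open>The orders increase strictly from at least 0, so only \<open>H 0\<close> can be
    empty.\<close>
  have "n \<le> card (verts (H n))"
    using assms strict_mono_imp_increasing[of "\<lambda>n. card (verts (H n))"]
    by (simp add: increasing_graph_seq_def)
  then show "n \<ge> 1 \<Longrightarrow> verts (H n) \<noteq> {}" by auto
qed

lemma quasi_random_if_C4:
  assumes H: "increasing_graph_seq H" and p: "p > 0"
    and q: "(\<lambda>n. hom_density K2 (H n)) \<longlonglongrightarrow> p" and c: "(\<lambda>n. C4_density (H n)) \<longlonglongrightarrow> p ^ 4"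
  shows "quasi_random p H"
  unfolding quasi_random_def
\<comment> \<open>As \<open>p\<close> is positive the target constant is nonzero, and convergence to
  it yields the asymptotic equivalence.\<close>
proof (intro conjI allI impI tendsto_imp_asymp_equiv_const)
  fix J :: "nat ugraph"
  assume J: "simple_graph J"
  let ?q = "\<lambda>n. hom_density K2 (H n)"
  let ?\<delta> = "\<lambda>n. C4_density (H n) - ?q n ^ 4"
  let ?err = "\<lambda>n. card (edges J) * sqrt (sqrt (?\<delta> n) + 2 * sqrt (sqrt (?\<delta> n)))"
  have "?\<delta> \<longlonglongrightarrow> p ^ 4 - p ^ 4"
    by (intro tendsto_intros q c)
  then have \<delta>: "?\<delta> \<longlonglongrightarrow> 0" by simp
  have "?err \<longlonglongrightarrow> card (edges J) * sqrt (sqrt 0 + 2 * sqrt (sqrt 0))"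
    by (intro tendsto_intros \<delta>)
  then have err: "?err \<longlonglongrightarrow> 0" by simp
  have "(\<lambda>n. hom_density J (H n) - ?q n ^ card (edges J)) \<longlonglongrightarrow> 0"
  proof (rule tendsto_0_le[OF err])
    show "\<forall>\<^sub>F n in sequentially.
        norm (hom_density J (H n) - ?q n ^ card (edges J)) \<le> norm (?err n) * 1"
      using eventually_ge_at_top[of 1]
    proof eventually_elim
      case (elim n)
      show ?case
        using C4_counting[OF J increasing_graph_seq_verts[OF H], OF elim] by simp
    qed
  qed
  then have "(\<lambda>n. hom_density J (H n) - ?q n ^ card (edges J) + ?q n ^ card (edges J))
      \<longlonglongrightarrow> 0 + p ^ card (edges J)"
    by (intro tendsto_intros q)
  then show "(\<lambda>n. hom_density J (H n)) \<longlonglongrightarrow> p ^ card (edges J)" by simp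
qed (use H p in auto)

theorem theorem1p3:
  fixes G :: "'a ugraph"
  assumes "simple_graph G"
    and "edges G \<noteq> {}"
    and "sidorenko G"
  shows "forcing (G \<box> K2)"
  unfolding forcing_def
proof (intro ballI allI impI)
  fix p :: real and H :: "nat \<Rightarrow> nat ugraph"
  assume p: "p \<in> {0..1}" and *: "increasing_graph_seq H \<and>
    (\<lambda>n. hom_density K2 (H n)) \<sim>[sequentially] (\<lambda>_. p) \<and>
    (\<lambda>n. hom_density (G \<box> K2) (H n)) \<sim>[sequentially] (\<lambda>_. p ^ card (edges (G \<box> K2)))"
  from * have H: "increasing_graph_seq H" by blast
  have simple: "simple_graph (H n)" for n
    using H by (simp add: increasing_graph_seq_def)
  note fin = increasing_graph_seq_verts(1)[OF H] and ne = increasing_graph_seq_verts(2)[OF H]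
  let ?q = "\<lambda>n. hom_density K2 (H n)" and ?t = "\<lambda>n. hom_density (G \<box> K2) (H n)"
  let ?v = "card (verts G)" and ?e = "card (edges G)"
  show "quasi_random p H"
  proof (cases "p = 0")
    case True
    \<comment> \<open>Asymptotic equivalence to 0 is eventual equality with 0, so \<open>H n\<close>
      eventually has no edges.\<close>
    then have "\<forall>\<^sub>F n in sequentially. ?q n = 0"
      using * by simp
    then have "\<forall>\<^sub>F n in sequentially. hom_density J (H n) = p ^ card (edges J)"
      if "simple_graph J" for J :: "nat ugraph"
      using eventually_ge_at_top[of 1]
    proof eventually_elim
      case (elim n)
      then show ?case
        using hom_density_edgeless[OF that fin ne] edgeless_if_hom_density_K2_eq_0[OF simple] True
        by simp
    qed
    then show ?thesis
      using H unfolding quasi_random_def by (auto intro: asymp_equiv_refl_ev)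
  next
    case False
    with p have p: "p > 0" by simp
    have e: "?e > 0"
      using assms finite_edges by (auto simp: card_gt_0_iff)
    have q: "?q \<longlonglongrightarrow> p" and t: "?t \<longlonglongrightarrow> p ^ (?v + 2 * ?e)"
      using * unfolding card_edges_box_K2[OF assms(1)] by (blast dest: asymp_equivD_const)+
    \<comment> \<open>The upper bound for the 4-cycle density converges to \<open>p ^ 4\<close>: the
      rungs cancel against \<open>p ^ ?v\<close>, and the root of the two layers leaves
      \<open>p\<^sup>2\<close>.\<close>
    have "(\<lambda>n. (?q n)\<^sup>2 * root ?e (?t n / ?q n ^ ?v)) \<longlonglongrightarrow> p\<^sup>2 * root ?e (p ^ (?v + 2 * ?e) / p ^ ?v)"
      using p by (intro tendsto_intros q t) auto
    also have "p ^ (?v + 2 * ?e) / p ^ ?v = (p\<^sup>2) ^ ?e"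
      using p by (simp add: power_add power_mult)
    also have "p\<^sup>2 * root ?e ((p\<^sup>2) ^ ?e) = p ^ 4"
      using e by (simp add: real_root_power_cancel power2_eq_square power4_eq_xxxx)
    finally have upper: "(\<lambda>n. (?q n)\<^sup>2 * root ?e (?t n / ?q n ^ ?v)) \<longlonglongrightarrow> p ^ 4" .
    have lower: "(\<lambda>n. ?q n ^ 4) \<longlonglongrightarrow> p ^ 4"
      by (intro tendsto_intros q)
    have "(\<lambda>n. C4_density (H n)) \<longlonglongrightarrow> p ^ 4"
    proof (rule tendsto_sandwich[OF _ _ lower upper])
      show "\<forall>\<^sub>F n in sequentially. ?q n ^ 4 \<le> C4_density (H n)"
        using eventually_ge_at_top[of 1]
        by eventually_elim (intro hom_density_K2_power4_le fin ne)
      show "\<forall>\<^sub>F n in sequentially. C4_density (H n) \<le> (?q n)\<^sup>2 * root ?e (?t n / ?q n ^ ?v)"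
        using order_tendstoD(1)[OF q p]
        by eventually_elim (intro C4_density_le_of_sidorenko assms simple)
    qed
    then show ?thesis
      by (rule quasi_random_if_C4[OF H p q])
  qed
qed

end
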